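(* If $P \in \mathcal{H}_n$, then the function $\mathbb{R} \ni \lambda \mapsto \max Z(D_\lambda P)$ is convex with a global minimum at $\lambda = 0$, while the function $\mathbb{R} \ni \lambda \mapsto \min Z(D_\lambda P)$ is concave with a global maximum at $\lambda = 0$.
   Context: $\mathcal{H}_n$ ($n\ge 1$) denotes the set of monic hyperbolic polynomials of degree $n$, i.e. monic polynomials of degree $n$ all of whose zeros are real. For a polynomial $P$ of degree $n$, $Z(P)$ is the unordered $n$-tuple of its zeros, each repeated according to multiplicity; for $P\in\mathcal{H}_n$, $\max Z(P)$ and $\min Z(P)$ are the largest and smallest zero of $P$. For $\lambda\in\mathbb{R}$, $D_\lambda = \left(1-\lambda\frac{d}{dx}\right)e^{\lambda\frac{d}{dx}}$, that is, $(D_\lambda P)(x) = P(x+\lambda) - \lambda P'(x+\lambda)$. By the Hermite–Poulain theorem, $D_\lambda$ maps $\mathcal{H}_n$ into $\mathcal{H}_n$. *)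

theory Defs
  imports "HOL-Analysis.Analysis" "HOL-Computational_Algebra.Computational_Algebra"
begin

(* Complex zeros with multiplicity, so that a polynomial of degree n > 0 has exactly n of them. *)
definition zeros :: "real poly \<Rightarrow> complex multiset" where
  "zeros P = proots (map_poly complex_of_real P)"

(* A monic polynomial with only real zeros has real coefficients, hence the type real poly. *)
definition hyperbolic :: "nat \<Rightarrow> real poly set" where
  "hyperbolic n = {P. degree P = n \<and> lead_coeff P = 1 \<and> (\<forall>z \<in># zeros P. z \<in> \<real>)}"

(* Meaningful for P in hyperbolic n with n > 0: the zeros of P are then real, and the sets
   below contain all of them and are non-empty. *)
definition max_zero :: "real poly \<Rightarrow> real" where
  "max_zero P = Max {x. complex_of_real x \<in># zeros P}"

definition min_zero :: "real poly \<Rightarrow> real" where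
  "min_zero P = Min {x. complex_of_real x \<in># zeros P}"

(* (1 - l d/dx) e^(l d/dx), where e^(l d/dx) is the shift P(x) |-> P(x + l). *)
definition D :: "real \<Rightarrow> real poly \<Rightarrow> real poly" where
  "D l P = pcompose P [:l, 1:] - smult l (pcompose (pderiv P) [:l, 1:])"

lemma poly_D: "poly (D l P) x = poly P (x + l) - l * poly (pderiv P) (x + l)"
  by (simp add: D_def poly_pcompose add.commute)

end

theory Submission
  imports Defs
begin

text \<open>
  Let \<open>x\<^sub>1, \<dots>, x\<^sub>n\<close> be the zeros of \<open>P\<close>, let \<open>X\<close> be the diagonal matrix with these entries,
  and let \<open>J\<close> be the \<open>n \<times> n\<close> matrix of ones. By the determinant formula for rank-one
  perturbations,
  \<open>det (u - X - \<lambda> J) = P(u) (1 - \<lambda> \<Sum>\<^sub>i 1 / (u - x\<^sub>i)) = P(u) - \<lambda> P'(u)\<close>,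
  and with \<open>u = y + \<lambda>\<close> this says that \<open>D\<^sub>\<lambda> P\<close> is the characteristic polynomial of the
  symmetric matrix \<open>A(\<lambda>) = X + \<lambda> (J - 1)\<close>.

  The theorem now follows from the variational description of the largest eigenvalue as the
  maximum of \<open>v \<bullet> A(\<lambda>) v\<close> over unit vectors \<open>v\<close>. For fixed \<open>v\<close> this number is an affine
  function of \<open>\<lambda>\<close>, and a maximum of affine functions is convex. The matrix \<open>J - 1\<close> has zero
  diagonal, so the unit coordinate vector at a largest \<open>x\<^sub>i\<close> gives the value \<open>x\<^sub>i = max Z(P)\<close> for
  every \<open>\<lambda>\<close>, which makes \<open>\<lambda> = 0\<close> a minimum. The smallest eigenvalue is handled by passing to
  \<open>- A(\<lambda>)\<close>, which is the matrix of the same kind built from \<open>- x\<^sub>i\<close> and \<open>- \<lambda>\<close>.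

  The argument avoids determinants. The relation between zeros and eigenvalues,
  \<open>pencil_eigenvalues_eq_zeros\<close>, is obtained by solving the eigenvector equation
  \<open>(u - x\<^sub>i) v\<^sub>i = \<lambda> \<Sum>\<^sub>j v\<^sub>j\<close> by hand, and the variational description,
  \<open>ex_dominating_pencil_eigenvalue\<close>, by maximising the quadratic form over the compact unit
  sphere.
\<close>

section \<open>The largest eigenvalue of \<open>X + \<lambda> (J - 1)\<close>\<close>

text \<open>
  This is \<open>v \<bullet> A(l) v\<close> for \<open>A(l) = X + l (J - 1)\<close>. Vectors and matrices are indexed by a finite
  set instead of a finite type, because in the application the dimension is the degree of a
  polynomial, a number that is fixed only inside a proof.
\<close>
definition pencil_form :: "'a set \<Rightarrow> ('a \<Rightarrow> real) \<Rightarrow> real \<Rightarrow> ('a \<Rightarrow> real) \<Rightarrow> real" where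
  "pencil_form I x l v =
     (\<Sum>i\<in>I. x i * (v i)\<^sup>2) + l * ((\<Sum>i\<in>I. v i)\<^sup>2 - (\<Sum>i\<in>I. (v i)\<^sup>2))"

text \<open>
  The defining equation is \<open>A(l) v = y v\<close> in coordinates. Only coordinates in \<open>I\<close> count, so an
  eigenvector must be nonzero somewhere on \<open>I\<close>.
\<close>
definition pencil_eigenvalues :: "'a set \<Rightarrow> ('a \<Rightarrow> real) \<Rightarrow> real \<Rightarrow> real set" where
  "pencil_eigenvalues I x l =
     {y. \<exists>v. (\<exists>i\<in>I. v i \<noteq> 0) \<and> (\<forall>i\<in>I. x i * v i + l * ((\<Sum>j\<in>I. v j) - v i) = y * v i)}"

lemma pencil_form_affine:
  assumes "a + b = 1"
  shows "pencil_form I x (a * l + b * m) v = a * pencil_form I x l v + b * pencil_form I x m v"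
proof -
  have b: "b = 1 - a" using assms by simp
  show ?thesis unfolding pencil_form_def b by (simp add: algebra_simps)
qed

text \<open>The perturbation \<open>J - 1\<close> has zero diagonal, so the parameter \<open>l\<close> is invisible to coordinate
  vectors. This is the source of the extremum at \<open>l = 0\<close>.\<close>
lemma pencil_form_unit:
  assumes "finite I" "i \<in> I"
  shows "pencil_form I x l (\<lambda>j. if j = i then 1 else 0) = x i"
  using assms by (simp add: pencil_form_def if_distrib[of "\<lambda>t. t\<^sup>2"] if_distrib[of "\<lambda>t. _ * t"] cong: if_cong)

lemma pencil_form_eigenvector:
  assumes "\<And>i. i \<in> I \<Longrightarrow> x i * v i + l * ((\<Sum>j\<in>I. v j) - v i) = y * v i"
  shows "pencil_form I x l v = y * (\<Sum>i\<in>I. (v i)\<^sup>2)"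
proof -
  have "y * (\<Sum>i\<in>I. (v i)\<^sup>2) = (\<Sum>i\<in>I. v i * (y * v i))"
    by (simp add: sum_distrib_left power2_eq_square mult_ac)
  also have "\<dots> = (\<Sum>i\<in>I. v i * (x i * v i + l * ((\<Sum>j\<in>I. v j) - v i)))"
    using assms by simp
  also have "\<dots> = pencil_form I x l v"
    by (simp add: pencil_form_def algebra_simps power2_eq_square sum.distrib sum_subtractf
        flip: sum_distrib_left sum_distrib_right)
  finally show ?thesis by simp
qed

lemma pencil_eigenvalueE:
  assumes "finite I" "y \<in> pencil_eigenvalues I x l"
  obtains v where "pencil_form I x l v = y * (\<Sum>i\<in>I. (v i)\<^sup>2)" "(\<Sum>i\<in>I. (v i)\<^sup>2) > 0"
    "\<exists>i\<in>I. v i \<noteq> 0" "\<And>i. i \<in> I \<Longrightarrow> x i * v i + l * ((\<Sum>j\<in>I. v j) - v i) = y * v i"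
proof -
  from assms(2) obtain v where v: "\<exists>i\<in>I. v i \<noteq> 0"
    "\<And>i. i \<in> I \<Longrightarrow> x i * v i + l * ((\<Sum>j\<in>I. v j) - v i) = y * v i"
    by (auto simp: pencil_eigenvalues_def)
  then obtain i where "i \<in> I" "v i \<noteq> 0" by blast
  then have "(\<Sum>i\<in>I. (v i)\<^sup>2) > 0"
    using assms(1) by (intro sum_pos2[of _ i]) auto
  with v show ?thesis
    by (intro that[of v] pencil_form_eigenvector) auto
qed

text \<open>The unit sphere of the coordinate subspace \<open>\<real>\<^sup>I\<close> is a closed subset of a product of intervals
  \<open>[-1, 1]\<close> and points \<open>{0}\<close>, which is compact by Tychonoff's theorem.\<close>
lemma compact_coordinate_sphere:
  fixes I :: "'a set"
  assumes "finite I"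
  shows "compact {v :: 'a \<Rightarrow> real. (\<forall>i. i \<notin> I \<longrightarrow> v i = 0) \<and> (\<Sum>i\<in>I. (v i)\<^sup>2) = 1}"
    (is "compact ?S")
proof -
  define B :: "('a \<Rightarrow> real) set" where
    "B = PiE UNIV (\<lambda>i. if i \<in> I then {-1..1} else {0})"
  have "compact B"
  proof -
    have "compactin (product_topology (\<lambda>i::'a. euclidean :: real topology) UNIV) B"
      unfolding B_def by (subst compactin_PiE) auto
    then show ?thesis
      by (simp add: euclidean_product_topology)
  qed
  moreover have "closed {v :: 'a \<Rightarrow> real. (\<Sum>i\<in>I. (v i)\<^sup>2) = 1}"
    by (intro closed_Collect_eq continuous_intros continuous_on_product_coordinates)
  moreover have "?S = B \<inter> {v. (\<Sum>i\<in>I. (v i)\<^sup>2) = 1}"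
  proof (intro equalityI subsetI)
    fix v assume v: "v \<in> ?S"
    have "\<bar>v i\<bar> \<le> 1" if "i \<in> I" for i
    proof -
      have "(v i)\<^sup>2 \<le> (\<Sum>i\<in>I. (v i)\<^sup>2)"
        using assms that by (intro member_le_sum) auto
      with v show ?thesis by (simp add: abs_square_le_1)
    qed
    with v show "v \<in> B \<inter> {v. (\<Sum>i\<in>I. (v i)\<^sup>2) = 1}"
      by (auto simp: B_def abs_le_iff)
  next
    fix v assume v: "v \<in> B \<inter> {v. (\<Sum>i\<in>I. (v i)\<^sup>2) = 1}"
    have "v i = 0" if "i \<notin> I" for i
    proof -
      have "v i \<in> (if i \<in> I then {-1..1} else {0})"
        using v by (auto simp: B_def PiE_iff)
      with that show ?thesis by simp
    qed
    with v show "v \<in> ?S" by simp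
  qed
  ultimately show ?thesis
    by (simp add: compact_Int_closed)
qed

lemma linear_coeff_zero_if_quadratic_nonpos:
  fixes a b :: real
  assumes "\<And>t. a * t + b * t\<^sup>2 \<le> 0"
  shows "a = 0"
proof (rule ccontr)
  assume "a \<noteq> 0"
  define c where "c = 1 + \<bar>b\<bar>"
  have c: "c > 0" "c + b > 0" by (auto simp: c_def)
  have "a * (a / c) + b * (a / c)\<^sup>2 = a\<^sup>2 * (c + b) / c\<^sup>2"
    using c(1) by (simp add: field_simps power2_eq_square)
  also have "\<dots> > 0"
    using \<open>a \<noteq> 0\<close> c by simp
  finally show False using assms[of "a / c"] by simp
qed

text \<open>The change of the quadratic form and of the squared norm when one coordinate moves by \<open>t\<close>. The
  coefficients of \<open>2 t\<close> are the coordinates of \<open>A(l) v\<close> and of \<open>v\<close>, so that comparing them at a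
  maximiser yields the eigenvector equation.\<close>
lemma pencil_form_add_unit:
  assumes "finite I" "i \<in> I"
  shows "pencil_form I x l (\<lambda>j. v j + (if j = i then t else 0)) =
     pencil_form I x l v + 2 * t * (x i * v i + l * ((\<Sum>j\<in>I. v j) - v i)) + x i * t\<^sup>2"
    and "(\<Sum>j\<in>I. (v j + (if j = i then t else 0))\<^sup>2) = (\<Sum>j\<in>I. (v j)\<^sup>2) + 2 * t * v i + t\<^sup>2"
proof -
  have split: "(\<Sum>j\<in>I. f j) = f i + (\<Sum>j\<in>I - {i}. f j)" for f :: "'a \<Rightarrow> real"
    using assms by (rule sum.remove)
  have rest: "(\<Sum>j\<in>I - {i}. f j (v j + (if j = i then t else 0))) = (\<Sum>j\<in>I - {i}. f j (v j))"
    for f :: "'a \<Rightarrow> real \<Rightarrow> real"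
    by (rule sum.cong) auto
  show "(\<Sum>j\<in>I. (v j + (if j = i then t else 0))\<^sup>2) = (\<Sum>j\<in>I. (v j)\<^sup>2) + 2 * t * v i + t\<^sup>2"
    by (simp add: split rest[of "\<lambda>_ s. s\<^sup>2"] power2_eq_square algebra_simps)
  show "pencil_form I x l (\<lambda>j. v j + (if j = i then t else 0)) =
     pencil_form I x l v + 2 * t * (x i * v i + l * ((\<Sum>j\<in>I. v j) - v i)) + x i * t\<^sup>2"
    unfolding pencil_form_def
    by (simp add: split rest[of "\<lambda>_ s. s\<^sup>2"] rest[of "\<lambda>j s. x j * s\<^sup>2"] rest[of "\<lambda>_ s. s"])
       (simp add: power2_eq_square algebra_simps)
qed

text \<open>The Rayleigh principle: the quadratic form attains its maximum \<open>y\<close> on the unit sphere at some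
  \<open>v\<close>, and by homogeneity \<open>y |w|\<^sup>2 - w \<bullet> A(l) w\<close> is nonnegative for every \<open>w\<close>. It vanishes at
  \<open>w = v\<close>, so its first-order variation there vanishes, which says \<open>A(l) v = y v\<close>.\<close>
lemma ex_dominating_pencil_eigenvalue:
  assumes "finite I" "I \<noteq> {}"
  shows "\<exists>y\<in>pencil_eigenvalues I x l. \<forall>v. pencil_form I x l v \<le> y * (\<Sum>i\<in>I. (v i)\<^sup>2)"
proof -
  define S where "S = {v :: 'a \<Rightarrow> real. (\<forall>i. i \<notin> I \<longrightarrow> v i = 0) \<and> (\<Sum>i\<in>I. (v i)\<^sup>2) = 1}"
  obtain k where k: "k \<in> I" using assms(2) by blast
  then have "(\<lambda>j. if j = k then 1 else 0) \<in> S"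
    using assms(1) by (auto simp: S_def if_distrib[of "\<lambda>t. t\<^sup>2"] cong: if_cong)
  then have "S \<noteq> {}" by blast
  moreover have "compact S"
    unfolding S_def by (rule compact_coordinate_sphere[OF assms(1)])
  moreover have "continuous_on S (pencil_form I x l)"
    unfolding pencil_form_def
    by (intro continuous_intros continuous_on_product_coordinates[THEN continuous_on_subset]) auto
  ultimately have "\<exists>v\<in>S. \<forall>w\<in>S. pencil_form I x l w \<le> pencil_form I x l v"
    by (intro continuous_attains_sup)
  then obtain v where v: "v \<in> S" "\<And>w. w \<in> S \<Longrightarrow> pencil_form I x l w \<le> pencil_form I x l v"
    by auto
  define y where "y = pencil_form I x l v"
  have bound: "pencil_form I x l w \<le> y * (\<Sum>i\<in>I. (w i)\<^sup>2)" for w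
  proof (cases "\<exists>i\<in>I. w i \<noteq> 0")
    case True
    define r where "r = (\<Sum>i\<in>I. (w i)\<^sup>2)"
    have r: "r > 0"
      using True assms(1) unfolding r_def by (auto intro: sum_pos2)
    define u where "u = (\<lambda>i. if i \<in> I then w i / sqrt r else 0)"
    have "(\<Sum>i\<in>I. (u i)\<^sup>2) = (\<Sum>i\<in>I. (w i)\<^sup>2 / r)"
      using r by (simp add: u_def power_divide)
    also have "\<dots> = r / r"
      unfolding r_def by (rule sum_divide_distrib[symmetric])
    finally have "(\<Sum>i\<in>I. (u i)\<^sup>2) = r / r" .
    then have "u \<in> S"
      using r by (simp add: S_def u_def)
    then have "pencil_form I x l u \<le> y"
      using v(2) by (simp add: y_def)
    moreover have "pencil_form I x l u = pencil_form I x l w / r"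
      using r by (simp add: pencil_form_def u_def power_divide add_divide_distrib
          flip: sum_divide_distrib) (simp add: field_simps)
    ultimately show ?thesis
      using r by (simp add: r_def divide_le_eq)
  next
    case False
    then show ?thesis by (simp add: pencil_form_def)
  qed
  have norm: "(\<Sum>i\<in>I. (v i)\<^sup>2) = 1" using v(1) by (simp add: S_def)
  have "x i * v i + l * ((\<Sum>j\<in>I. v j) - v i) = y * v i" if i: "i \<in> I" for i
  proof -
    let ?c = "2 * (x i * v i + l * ((\<Sum>j\<in>I. v j) - v i) - y * v i)"
    have "?c * t + (x i - y) * t\<^sup>2 \<le> 0" for t
      using bound[of "\<lambda>j. v j + (if j = i then t else 0)"]
      unfolding pencil_form_add_unit[OF assms(1) i] norm y_def[symmetric]
      by (simp add: algebra_simps)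
    then have "?c = 0" by (rule linear_coeff_zero_if_quadratic_nonpos)
    then show ?thesis by simp
  qed
  moreover have "\<exists>i\<in>I. v i \<noteq> 0"
    using norm by (metis (no_types, lifting) power_zero_numeral sum.neutral zero_neq_one)
  ultimately have "y \<in> pencil_eigenvalues I x l"
    by (auto simp: pencil_eigenvalues_def)
  with bound show ?thesis by blast
qed

lemma dominating_pencil_eigenvalue_is_Max:
  assumes "finite I" "finite (pencil_eigenvalues I x l)" "y \<in> pencil_eigenvalues I x l"
    and "\<And>v. pencil_form I x l v \<le> y * (\<Sum>i\<in>I. (v i)\<^sup>2)"
  shows "Max (pencil_eigenvalues I x l) = y"
proof (rule Max_eqI)
  fix z assume "z \<in> pencil_eigenvalues I x l"
  with assms(1) obtain v where
    "pencil_form I x l v = z * (\<Sum>i\<in>I. (v i)\<^sup>2)" "(\<Sum>i\<in>I. (v i)\<^sup>2) > 0"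
    by (rule pencil_eigenvalueE)
  with assms(4)[of v] show "z \<le> y" by simp
qed (use assms in auto)

lemma Max_pencil_eigenvalues:
  assumes "finite I" "I \<noteq> {}" "finite (pencil_eigenvalues I x l)"
  shows "Max (pencil_eigenvalues I x l) \<in> pencil_eigenvalues I x l"
    and "pencil_form I x l v \<le> Max (pencil_eigenvalues I x l) * (\<Sum>i\<in>I. (v i)\<^sup>2)"
proof -
  obtain y where "y \<in> pencil_eigenvalues I x l"
    "\<And>v. pencil_form I x l v \<le> y * (\<Sum>i\<in>I. (v i)\<^sup>2)"
    using ex_dominating_pencil_eigenvalue[OF assms(1,2)] by blast
  then show "Max (pencil_eigenvalues I x l) \<in> pencil_eigenvalues I x l"
    and "pencil_form I x l v \<le> Max (pencil_eigenvalues I x l) * (\<Sum>i\<in>I. (v i)\<^sup>2)"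
    using dominating_pencil_eigenvalue_is_Max[OF assms(1,3)] by simp_all
qed

text \<open>A maximum of affine functions is convex: the eigenvector that realises the maximum at an
  intermediate parameter is a competitor at both end parameters.\<close>
lemma convex_on_Max_pencil_eigenvalues:
  assumes I: "finite I" "I \<noteq> {}" and fin: "\<And>l. finite (pencil_eigenvalues I x l)"
  shows "convex_on UNIV (\<lambda>l. Max (pencil_eigenvalues I x l))"
  unfolding convex_on_def
proof (intro conjI ballI allI impI)
  let ?M = "\<lambda>l. Max (pencil_eigenvalues I x l)"
  fix l m a b :: real assume ab: "0 \<le> a" "0 \<le> b" "a + b = 1"
  obtain v where v: "pencil_form I x (a * l + b * m) v = ?M (a * l + b * m) * (\<Sum>i\<in>I. (v i)\<^sup>2)"
    "(\<Sum>i\<in>I. (v i)\<^sup>2) > 0"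
    using pencil_eigenvalueE[OF I(1) Max_pencil_eigenvalues(1)[OF I fin]] by blast
  have "?M (a * l + b * m) * (\<Sum>i\<in>I. (v i)\<^sup>2) = a * pencil_form I x l v + b * pencil_form I x m v"
    using v(1) pencil_form_affine[OF ab(3)] by metis
  also have "\<dots> \<le> a * (?M l * (\<Sum>i\<in>I. (v i)\<^sup>2)) + b * (?M m * (\<Sum>i\<in>I. (v i)\<^sup>2))"
    using ab Max_pencil_eigenvalues(2)[OF I fin] by (intro add_mono mult_left_mono)
  also have "\<dots> = (a * ?M l + b * ?M m) * (\<Sum>i\<in>I. (v i)\<^sup>2)"
    by (simp add: algebra_simps)
  finally show "?M (a *\<^sub>R l + b *\<^sub>R m) \<le> a * ?M l + b * ?M m"
    using v(2) by simp
qed simp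

text \<open>At parameter \<open>0\<close> the matrix is diagonal and its largest eigenvalue is one of its entries
  \<open>x\<^sub>i\<close>. The \<open>i\<close>-th coordinate vector attains this same value for every \<open>l\<close>.\<close>
lemma Max_pencil_eigenvalues_min_at_0:
  assumes I: "finite I" "I \<noteq> {}" and fin: "\<And>l. finite (pencil_eigenvalues I x l)"
  shows "Max (pencil_eigenvalues I x 0) \<le> Max (pencil_eigenvalues I x l)"
proof -
  let ?M = "\<lambda>l. Max (pencil_eigenvalues I x l)"
  obtain v where v: "\<exists>i\<in>I. v i \<noteq> 0"
    "\<And>i. i \<in> I \<Longrightarrow> x i * v i + 0 * ((\<Sum>j\<in>I. v j) - v i) = ?M 0 * v i"
    using pencil_eigenvalueE[OF I(1) Max_pencil_eigenvalues(1)[OF I fin]] by blast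
  then obtain i where "i \<in> I" "v i \<noteq> 0" by blast
  with v(2)[of i] have i: "i \<in> I" "?M 0 = x i" by simp_all
  have "x i = pencil_form I x l (\<lambda>j. if j = i then 1 else 0)"
    using I i by (simp add: pencil_form_unit)
  also have "\<dots> \<le> ?M l * (\<Sum>j\<in>I. (if j = i then 1 else 0)\<^sup>2)"
    by (rule Max_pencil_eigenvalues(2)[OF I fin])
  also have "\<dots> = ?M l"
    using I i by (simp add: if_distrib[of "\<lambda>t. t\<^sup>2"] cong: if_cong)
  finally show ?thesis using i by simp
qed

text \<open>The matrix built from \<open>- x\<close> and \<open>- l\<close> is \<open>- A(l)\<close>, so results on largest eigenvalues transfer
  to smallest ones.\<close>
lemma pencil_eigenvalues_uminus:
  "pencil_eigenvalues I (\<lambda>i. - x i) (- l) = uminus ` pencil_eigenvalues I x l"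
proof -
  have neg: "z \<in> pencil_eigenvalues I (\<lambda>i. - w i) (- k)"
    if "- z \<in> pencil_eigenvalues I w k" for z w k
    using that unfolding pencil_eigenvalues_def
    by (auto simp: algebra_simps)
  have "- z \<in> pencil_eigenvalues I x l" if "z \<in> pencil_eigenvalues I (\<lambda>i. - x i) (- l)" for z
    using neg[of "- z" "\<lambda>i. - x i" "- l"] that by simp
  then show ?thesis
    using neg by (auto simp: image_iff) (metis add.inverse_inverse)
qed

section \<open>Zeros of \<open>D\<^sub>\<lambda> P\<close> as eigenvalues\<close>

lemma poly_pderiv_prod_linear:
  fixes x :: "'a \<Rightarrow> real"
  shows "poly (pderiv (\<Prod>i\<in>I. [:- x i, 1:])) u = (\<Sum>i\<in>I. \<Prod>j\<in>I - {i}. u - x j)"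
  by (simp add: pderiv_prod poly_sum poly_prod pderiv_pCons)

text \<open>Put \<open>u = y + l\<close>. Then \<open>y\<close> is a zero of \<open>D l P\<close> iff \<open>P(u) = l P'(u)\<close>, and \<open>v\<close> is an eigenvector
  iff \<open>(u - x\<^sub>i) v\<^sub>i = l s\<close> for all \<open>i\<close>, where \<open>s\<close> is the sum of the coordinates of \<open>v\<close>. When
  \<open>P(u) \<noteq> 0\<close>, the latter forces \<open>v\<close> to be proportional to \<open>1 / (u - x\<^sub>i)\<close>, and summing the
  coordinates gives \<open>l P'(u) / P(u) = 1\<close>. When \<open>P(u) = 0\<close>, both conditions say that \<open>l = 0\<close> or that
  \<open>u\<close> is a multiple zero \<open>x\<^sub>i = x\<^sub>k\<close>: multiplicity makes \<open>P'(u)\<close> vanish, and it provides the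
  eigenvector \<open>e\<^sub>i - e\<^sub>k\<close>, whose coordinate sum is zero.\<close>
lemma pencil_eigenvalues_eq_zeros:
  fixes x :: "'a \<Rightarrow> real"
  assumes I: "finite I"
  defines "P \<equiv> \<Prod>i\<in>I. [:- x i, 1:]"
  shows "pencil_eigenvalues I x l = {y. poly (D l P) y = 0}"
proof (intro equalityI subsetI CollectI)
  fix y assume "y \<in> pencil_eigenvalues I x l"
  then obtain v where v: "\<exists>i\<in>I. v i \<noteq> 0"
    "\<And>i. i \<in> I \<Longrightarrow> x i * v i + l * ((\<Sum>j\<in>I. v j) - v i) = y * v i"
    by (auto simp: pencil_eigenvalues_def)
  define u where "u = y + l"
  define s where "s = (\<Sum>j\<in>I. v j)"
  have eig: "(u - x i) * v i = l * s" if "i \<in> I" for i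
    using v(2)[OF that] by (simp add: u_def s_def algebra_simps)
  have "poly P u - l * poly (pderiv P) u = 0"
  proof (cases "l * s = 0")
    case False
    then have ne: "u - x i \<noteq> 0" if "i \<in> I" for i
      using eig[OF that] by auto
    have "s * poly P u = l * s * poly (pderiv P) u"
    proof -
      have "s * poly P u = (\<Sum>i\<in>I. v i * poly P u)"
        by (simp add: s_def sum_distrib_right)
      also have "\<dots> = (\<Sum>i\<in>I. l * s * (\<Prod>j\<in>I - {i}. u - x j))"
      proof (rule sum.cong[OF refl])
        fix i assume i: "i \<in> I"
        have "poly P u = (u - x i) * (\<Prod>j\<in>I - {i}. u - x j)"
          using I i by (simp add: P_def poly_prod prod.remove algebra_simps)
        then show "v i * poly P u = l * s * (\<Prod>j\<in>I - {i}. u - x j)"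
          using eig[OF i] by (simp add: mult_ac)
      qed
      also have "\<dots> = l * s * poly (pderiv P) u"
        by (simp add: P_def poly_pderiv_prod_linear sum_distrib_left)
      finally show ?thesis .
    qed
    with False show ?thesis by simp
  next
    case True
    obtain i where i: "i \<in> I" "v i \<noteq> 0" using v(1) by blast
    with True eig have xi: "u = x i" by force
    with i I have P0: "poly P u = 0" by (auto simp: P_def poly_prod)
    show ?thesis
    proof (cases "l = 0")
      case True
      with P0 show ?thesis by simp
    next
      case False
      with True have "s = 0" by simp
      \<comment> \<open>As the coordinates sum to zero, a second one is nonzero, so \<open>u\<close> is a multiple zero.\<close>
      then have "(\<Sum>j\<in>I - {i}. v j) \<noteq> 0"
        using I i by (simp add: s_def sum.remove)
      then obtain k where k: "k \<in> I" "k \<noteq> i" "v k \<noteq> 0"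
        by (metis (no_types, lifting) Diff_iff insertI1 sum.neutral)
      with True eig have xk: "u = x k" by force
      have "(\<Prod>j\<in>I - {m}. u - x j) = 0" if "m \<in> I" for m
      proof (cases "m = i")
        case True
        then show ?thesis using I k xk by (intro prod_zero) auto
      next
        case False
        then show ?thesis using I i xi by (intro prod_zero) auto
      qed
      then have "poly (pderiv P) u = 0"
        unfolding P_def poly_pderiv_prod_linear by simp
      with P0 show ?thesis by simp
    qed
  qed
  then show "poly (D l P) y = 0" by (simp add: poly_D u_def)
next
  fix y assume "y \<in> {y. poly (D l P) y = 0}"
  define u where "u = y + l"
  have root: "poly P u = l * poly (pderiv P) u"
    using \<open>y \<in> _\<close> by (simp add: poly_D u_def)
  have eigI: "y \<in> pencil_eigenvalues I x l"
    if "\<exists>i\<in>I. v i \<noteq> 0" "\<And>i. i \<in> I \<Longrightarrow> (u - x i) * v i = l * (\<Sum>j\<in>I. v j)" for v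
    using that unfolding pencil_eigenvalues_def u_def
    by (intro CollectI exI[of _ v]) (auto simp: algebra_simps)
  show "y \<in> pencil_eigenvalues I x l"
  proof (cases "poly P u = 0")
    case False
    then have ne: "u - x i \<noteq> 0" if "i \<in> I" for i
      using that I by (auto simp: P_def poly_prod)
    have "I \<noteq> {}" using False root by (auto simp: P_def)
    have "poly (pderiv P) u = (\<Sum>i\<in>I. poly P u * (1 / (u - x i)))"
      unfolding P_def poly_pderiv_prod_linear
      using I ne by (intro sum.cong) (auto simp: poly_prod prod.remove field_simps)
    also have "\<dots> = poly P u * (\<Sum>i\<in>I. 1 / (u - x i))"
      by (rule sum_distrib_left[symmetric])
    finally have "poly P u = poly P u * (l * (\<Sum>i\<in>I. 1 / (u - x i)))"
      using root by (simp add: mult_ac)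
    then have "l * (\<Sum>i\<in>I. 1 / (u - x i)) = 1" using False by simp
    then show ?thesis
      using ne \<open>I \<noteq> {}\<close> by (intro eigI[of "\<lambda>i. 1 / (u - x i)"]) auto
  next
    case True
    then obtain i where i: "i \<in> I" "u = x i"
      using I by (auto simp: P_def poly_prod)
    show ?thesis
    proof (cases "l = 0")
      case True
      with i show ?thesis by (intro eigI[of "\<lambda>j. if j = i then 1 else 0"]) auto
    next
      case False
      then have "poly (pderiv P) u = 0" using root True by simp
      moreover have "(\<Sum>m\<in>I - {i}. \<Prod>j\<in>I - {m}. u - x j) = 0"
      proof (rule sum.neutral, rule ballI)
        fix m assume "m \<in> I - {i}"
        then show "(\<Prod>j\<in>I - {m}. u - x j) = 0"
          using I i by (intro prod_zero) auto
      qed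
      \<comment> \<open>Of the summands of \<open>P'(u)\<close>, only the one omitting \<open>u - x i\<close> could survive.\<close>
      ultimately have "(\<Prod>j\<in>I - {i}. u - x j) = 0"
        using I i unfolding P_def poly_pderiv_prod_linear by (simp add: sum.remove)
      then obtain k where k: "k \<in> I" "k \<noteq> i" "u = x k" using I by auto
      define v :: "'a \<Rightarrow> real" where
        "v = (\<lambda>j. (if j = i then 1 else 0) - (if j = k then 1 else 0))"
      have "(\<Sum>j\<in>I. v j) = 0"
        using I i k by (simp add: v_def sum_subtractf)
      then show ?thesis
        using i k by (intro eigI[of v]) (auto simp: v_def)
    qed
  qed
qed

section \<open>Zeros of hyperbolic polynomials\<close>

lemma poly_map_poly_of_real:
  "poly (map_poly complex_of_real P) (complex_of_real t) = complex_of_real (poly P t)"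
  by (induction P) (auto simp: map_poly_pCons)

lemma hyperbolic_eq_prod_linear:
  assumes "P \<in> hyperbolic n"
  obtains x :: "nat \<Rightarrow> real" where "P = (\<Prod>i<n. [:- x i, 1:])"
proof -
  let ?Q = "map_poly complex_of_real P"
  have P: "degree P = n" "lead_coeff P = 1" and re: "\<And>z. z \<in># proots ?Q \<Longrightarrow> z \<in> \<real>"
    using assms by (auto simp: hyperbolic_def zeros_def)
  have Q: "degree ?Q = n" "lead_coeff ?Q = 1" "?Q \<noteq> 0"
    using P by (auto simp: degree_map_poly coeff_map_poly map_poly_eq_0_iff)
  obtain root where "smult (lead_coeff ?Q) (\<Prod>i<degree ?Q. [:- root i, 1:]) = ?Q"
    by (rule complex_poly_decompose')
  then have root: "?Q = (\<Prod>i<n. [:- root i, 1:])" using Q by simp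
  have of_Re: "complex_of_real (Re (root i)) = root i" if "i < n" for i
  proof -
    have "poly ?Q (root i) = 0"
      using that unfolding root poly_prod by (intro prod_zero) auto
    then have "root i \<in> \<real>" using Q(3) by (intro re) simp
    then show ?thesis by (simp add: of_real_Re)
  qed
  have "poly P t = poly (\<Prod>i<n. [:- Re (root i), 1:]) t" for t
  proof -
    have "complex_of_real (poly P t) = (\<Prod>i<n. complex_of_real t - root i)"
      unfolding poly_map_poly_of_real[symmetric] root by (simp add: poly_prod)
    also have "\<dots> = (\<Prod>i<n. complex_of_real (t - Re (root i)))"
      by (rule prod.cong) (auto simp: of_Re)
    also have "\<dots> = complex_of_real (poly (\<Prod>i<n. [:- Re (root i), 1:]) t)"
      by (simp add: poly_prod)
    finally show ?thesis by (simp only: of_real_eq_iff)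
  qed
  then have "P = (\<Prod>i<n. [:- Re (root i), 1:])"
    by (intro poly_eq_poly_eq_iff[THEN iffD1] ext)
  then show ?thesis by (rule that)
qed

text \<open>This excludes the zero polynomial, whose multiset of zeros is empty by convention and would
  not reflect its actual zeros. Shifting keeps the degree, whereas differentiation lowers it, so
  the two terms of \<open>D l P\<close> cannot cancel.\<close>
lemma D_nonzero:
  assumes "degree P > 0"
  shows "D l P \<noteq> 0"
proof
  assume "D l P = 0"
  then have "pcompose P [:l, 1:] = smult l (pcompose (pderiv P) [:l, 1:])"
    by (simp add: D_def)
  moreover have "degree P = degree (pcompose P [:l, 1:])"
    by (simp add: degree_pcompose)
  ultimately have "degree P = degree (smult l (pcompose (pderiv P) [:l, 1:]))"
    by simp
  also have "\<dots> \<le> degree (pderiv P)"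
    using degree_smult_le[of l "pcompose (pderiv P) [:l, 1:]"] by (simp add: degree_pcompose)
  finally show False using assms by (simp add: degree_pderiv)
qed

lemma real_zeros_D:
  assumes "degree P > 0"
  shows "{x. complex_of_real x \<in># zeros (D l P)} = {x. poly (D l P) x = 0}"
proof -
  have "map_poly complex_of_real (D l P) \<noteq> 0"
    using D_nonzero[OF assms] by (simp add: map_poly_eq_0_iff)
  then show ?thesis
    by (simp add: zeros_def poly_map_poly_of_real)
qed

theorem theorem6:
  fixes n :: nat and P :: "real poly"
  assumes "n \<ge> 1" and "P \<in> hyperbolic n"
  shows "convex_on UNIV (\<lambda>l. max_zero (D l P)) \<and>
         (\<forall>l. max_zero (D 0 P) \<le> max_zero (D l P)) \<and>
         concave_on UNIV (\<lambda>l. min_zero (D l P)) \<and>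
         (\<forall>l. min_zero (D l P) \<le> min_zero (D 0 P))"
proof -
  obtain x where x: "P = (\<Prod>i<n. [:- x i, 1:])"
    using assms(2) by (rule hyperbolic_eq_prod_linear)
  have deg: "degree P > 0" using assms by (simp add: hyperbolic_def)
  define I where "I = {..<n}"
  have I: "finite I" "I \<noteq> {}" using assms(1) by (auto simp: I_def lessThan_empty_iff)
  have zeros: "{x. complex_of_real x \<in># zeros (D l P)} = pencil_eigenvalues I x l" for l
    using pencil_eigenvalues_eq_zeros[OF I(1), of x l] real_zeros_D[OF deg, of l]
    by (simp add: x I_def)
  have fin: "finite (pencil_eigenvalues I x l)" for l
    unfolding pencil_eigenvalues_eq_zeros[OF I(1)]
    using poly_roots_finite[OF D_nonzero[OF deg]] by (simp add: x I_def)
  have max: "max_zero (D l P) = Max (pencil_eigenvalues I x l)" for l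
    by (simp add: max_zero_def zeros)
  let ?N = "\<lambda>l. Max (pencil_eigenvalues I (\<lambda>i. - x i) l)"
  have fin': "finite (pencil_eigenvalues I (\<lambda>i. - x i) l)" for l
    using pencil_eigenvalues_uminus[of I x "- l"] fin by simp
  have min: "min_zero (D l P) = - ?N (- l)" for l
  proof -
    have "pencil_eigenvalues I x l \<noteq> {}"
      using Max_pencil_eigenvalues(1)[OF I fin] by blast
    then show ?thesis
      unfolding min_zero_def zeros pencil_eigenvalues_uminus
      using minus_Min_eq_Max[OF fin, of l, symmetric] by simp
  qed
  have conv: "convex_on UNIV ?N"
    by (rule convex_on_Max_pencil_eigenvalues[OF I fin'])
  have "convex_on UNIV (\<lambda>l. ?N (- l))"
    unfolding convex_on_def
  proof (intro conjI ballI allI impI)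
    fix l m a b :: real assume "0 \<le> a" "0 \<le> b" "a + b = 1"
    then have "?N (a *\<^sub>R (- l) + b *\<^sub>R (- m)) \<le> a * ?N (- l) + b * ?N (- m)"
      using conv unfolding convex_on_def by blast
    then show "?N (- (a *\<^sub>R l + b *\<^sub>R m)) \<le> a * ?N (- l) + b * ?N (- m)"
      by simp
  qed simp
  then show ?thesis
    using convex_on_Max_pencil_eigenvalues[OF I fin] Max_pencil_eigenvalues_min_at_0[OF I fin]
      Max_pencil_eigenvalues_min_at_0[OF I fin']
    by (simp add: max min concave_on_def)
qed

end
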